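(* Let $\{F_\alpha(z)\}$ be a family of formal power series in $\mathbb C[[z]]$ (indexed by complex weights $\alpha$ including all $\alpha=r+1/2$ with $r\ge0$ an integer) such that $F_\alpha$ is Möbius-covariant of weight $\alpha$. Let $r\ge1$ be an integer, $\alpha:=r+1/2$, and write $F_{r+1/2}(z)=\sum_{m\ge0}f_m^{(r)}z^m$. For $0\le j\le r$ let $$\kappa_{r,j}^F:=\frac{1}{r+1/2}\,[z^r]\,F_{r+1/2}(z)\,A_C(z)\,U_C(z)^j,$$ with $U_C$, $A_C$ the Catalan-type series defined in the context, and let $$R_{r,F}^{\pm}(x):=\frac1\alpha\,[z^r]\,\frac{F_\alpha(\pm z)}{1-xz},\qquad D_{r,F}(x):=R_{r,F}^-(x)-R_{r,F}^+(x),\qquad s_{r,F}(n):=\sqrt n\,D_{r,F}(n).$$ Then, for every positive integer $n$, $$\sum_{\ell=1}^ns_{r,F}(\ell)=C_{r,F}+\sqrt n\,\bigl(R_{r,F}^-(n)-\kappa_{r,0}^F\bigr)+\sum_{j=1}^r\kappa_{r,j}^F\,\tau_{\mathrm R}(n,2j+1),$$ where $$C_{r,F}:=s_{r,F}(1)-R_{r,F}^-(1)+\kappa_{r,0}^F-\sum_{j=1}^r\kappa_{r,j}^F\,\tau_{\mathrm R}(1,2j+1).$$ Moreover, $$D_{r,F}(x)=-\frac{2}{r+1/2}\sum_{\substack{1\le m\le r\\ m\text{ odd}}}f_m^{(r)}x^{r-m},$$ and hence $$s_{r,F}(n)=-\frac{2}{r+1/2}\sum_{\substack{1\le m\le r\\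 m\text{ odd}}}f_m^{(r)}n^{r-m+1/2}.$$
   Context: $[z^r]H(z)$ denotes the coefficient of $z^r$ in the formal power series $H(z)$. For $\beta\in\mathbb C$, $(1-z)^\beta:=\sum_{k\ge0}\binom{\beta}{k}(-z)^k$. A series $F\in\mathbb C[[z]]$ is Möbius-covariant of weight $\alpha$ if $F\!\left(-\frac{z}{1-z}\right)=(1-z)^{-\alpha}F(z)$ in $\mathbb C[[z]]$. Let $C(z):=\frac{1-\sqrt{1-4z}}{2z}\in\mathbb C[[z]]$ be the Catalan generating series, and put $$U_C(z):=C(z/4)-1,\qquad A_C(z):=\frac{2-C(z/4)}{1-z}$$ as formal power series in $z$. For integers $n\ge0$ and $m\ge3$, the Ramanujan tail is the convergent series $$\tau_{\mathrm R}(n,m):=\sum_{\nu\ge0}\frac{1}{\bigl(\sqrt{n+\nu}+\sqrt{n+\nu+1}\bigr)^m}.$$ *)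

theory Defs
  imports Complex_Main "HOL-Computational_Algebra.Formal_Power_Series"
begin

definition one_minus_pow :: "complex \<Rightarrow> complex fps" where
  "one_minus_pow \<beta> = Abs_fps (\<lambda>k. (\<beta> gchoose k) * (-1) ^ k)"

definition mobius_covariant :: "complex \<Rightarrow> complex fps \<Rightarrow> bool" where
  "mobius_covariant \<alpha> F \<longleftrightarrow>
     fps_compose F (- (fps_X / (1 - fps_X))) = one_minus_pow (- \<alpha>) * F"

text \<open>
  The square root of \<open>1 - 4 z\<close> is the binomial series with exponent \<open>1/2\<close> at \<open>4 z\<close>.
  Its constant term is \<open>1\<close>, so the division by \<open>2 z\<close> is exact.
\<close>

definition catalan_series :: "complex fps" where
  "catalan_series =
     (1 - fps_compose (one_minus_pow (1/2)) (fps_const 4 * fps_X)) / (fps_const 2 * fps_X)"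

definition U_C :: "complex fps" where
  "U_C = fps_compose catalan_series (fps_const (1/4) * fps_X) - 1"

definition A_C :: "complex fps" where
  "A_C = (fps_const 2 - fps_compose catalan_series (fps_const (1/4) * fps_X)) / (1 - fps_X)"

definition ramanujan_tail :: "nat \<Rightarrow> nat \<Rightarrow> real" where
  "ramanujan_tail n m =
     (\<Sum>\<nu>. 1 / (sqrt (real n + real \<nu>) + sqrt (real n + real \<nu> + 1)) ^ m)"

lemma summable_ramanujan_tail:
  assumes "m \<ge> 3"
  shows "summable (\<lambda>\<nu>. 1 / (sqrt (real n + real \<nu>) + sqrt (real n + real \<nu> + 1)) ^ m)"
proof (rule summable_comparison_test)
  show "\<exists>N. \<forall>\<nu>\<ge>N. norm (1 / (sqrt (real n + real \<nu>) + sqrt (real n + real \<nu> + 1)) ^ m)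
          \<le> 2 * (1 / sqrt (real n + real \<nu>) - 1 / sqrt (real n + real (Suc \<nu>)))"
  proof (intro exI[of _ 1] allI impI)
    fix \<nu> :: nat assume \<nu>: "\<nu> \<ge> 1"
    define a where "a = sqrt (real n + real \<nu>)"
    define b where "b = sqrt (real n + real \<nu> + 1)"
    have a1: "a \<ge> 1" and ab: "a \<le> b" using \<nu> by (auto simp: a_def b_def)
    have sq: "(b - a) * (a + b) = 1"
      by (simp add: a_def b_def algebra_simps)
    have "(a + b) ^ 3 \<le> (a + b) ^ m"
      by (rule power_increasing) (use assms a1 ab in auto)
    hence "1 / (a + b) ^ m \<le> 1 / (a + b) ^ 3"
      using a1 ab by (intro divide_left_mono) auto
    also have "\<dots> \<le> 1 / ((a * b) * (a + b))"
    proof (rule divide_left_mono)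
      have "(a * b) * (a + b) \<le> (a + b)\<^sup>2 * (a + b)"
        using a1 ab by (intro mult_right_mono) (auto simp: power2_eq_square algebra_simps)
      thus "(a * b) * (a + b) \<le> (a + b) ^ 3"
        by (simp add: power3_eq_cube power2_eq_square)
    qed (use a1 ab in auto)
    also have "\<dots> = (b - a) / (a * b)"
    proof -
      have "1 / ((a * b) * (a + b)) = ((b - a) * (a + b)) / ((a * b) * (a + b))"
        by (simp only: sq)
      also have "\<dots> = (b - a) / (a * b)"
        using a1 ab by simp
      finally show ?thesis .
    qed
    also have "\<dots> = 1 / a - 1 / b"
      using a1 ab by (simp add: field_simps)
    also have "\<dots> \<le> 2 * (1 / a - 1 / b)"
      using a1 ab by (simp add: field_simps)
    finally show "norm (1 / (sqrt (real n + real \<nu>) + sqrt (real n + real \<nu> + 1)) ^ m)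
        \<le> 2 * (1 / sqrt (real n + real \<nu>) - 1 / sqrt (real n + real (Suc \<nu>)))"
      using a1 ab by (simp add: a_def b_def add_ac)
  qed
  have "(\<lambda>\<nu>. 1 / sqrt (real n + real \<nu>)) \<longlonglongrightarrow> 0"
    by (intro tendsto_divide_0[OF tendsto_const] filterlim_at_top_imp_at_infinity
          filterlim_compose[OF sqrt_at_top] filterlim_tendsto_add_at_top[OF tendsto_const]
          filterlim_real_sequentially)
  from telescope_summable'[OF this]
  show "summable (\<lambda>\<nu>. 2 * (1 / sqrt (real n + real \<nu>) - 1 / sqrt (real n + real (Suc \<nu>))))"
    by (rule summable_mult)
qed

definition half_weight :: "nat \<Rightarrow> complex" where
  "half_weight r = of_nat r + 1/2"

definition kappa :: "(complex \<Rightarrow> complex fps) \<Rightarrow> nat \<Rightarrow> nat \<Rightarrow> complex" where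
  "kappa F r j = 1 / half_weight r * fps_nth (F (half_weight r) * A_C * U_C ^ j) r"

definition R_plus :: "(complex \<Rightarrow> complex fps) \<Rightarrow> nat \<Rightarrow> complex \<Rightarrow> complex" where
  "R_plus F r x =
     1 / half_weight r * fps_nth (F (half_weight r) / (1 - fps_const x * fps_X)) r"

definition R_minus :: "(complex \<Rightarrow> complex fps) \<Rightarrow> nat \<Rightarrow> complex \<Rightarrow> complex" where
  "R_minus F r x =
     1 / half_weight r *
       fps_nth (fps_compose (F (half_weight r)) (- fps_X) / (1 - fps_const x * fps_X)) r"

definition D_diff :: "(complex \<Rightarrow> complex fps) \<Rightarrow> nat \<Rightarrow> complex \<Rightarrow> complex" where
  "D_diff F r x = R_minus F r x - R_plus F r x"

definition s_term :: "(complex \<Rightarrow> complex fps) \<Rightarrow> nat \<Rightarrow> nat \<Rightarrow> complex" where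
  "s_term F r n = of_real (sqrt (real n)) * D_diff F r (of_nat n)"

definition C_const :: "(complex \<Rightarrow> complex fps) \<Rightarrow> nat \<Rightarrow> complex" where
  "C_const F r =
     s_term F r 1 - R_minus F r 1 + kappa F r 0
       - (\<Sum>j=1..r. kappa F r j * of_real (ramanujan_tail 1 (2 * j + 1)))"

end

theory Submission
  imports Defs
begin

text \<open>
  Put \<open>q = (1 - z)\<^sup>1\<^sup>/\<^sup>2\<close>. Then \<open>U\<^sub>C = (1 - q) / (1 + q)\<close> and \<open>A\<^sub>C = 2 / (q (1 + q))\<close>. Since
  \<open>\<tau>\<^sub>R(n + 1, m) - \<tau>\<^sub>R(n, m) = - \<omega>\<^sup>m\<close> with \<open>\<omega> = b - a\<close>, \<open>a = \<surd>n\<close>, \<open>b = \<surd>(n + 1)\<close>, the summation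
  formula telescopes down to
  \<open>b R\<^sup>+(b\<^sup>2) - a R\<^sup>-(a\<^sup>2) = \<Sum>\<^sub>j \<kappa>\<^sub>j \<omega>\<^sup>2\<^sup>j\<^sup>+\<^sup>1\<close>.
  The substitution \<open>z \<mapsto> z / (1 - z)\<close> and covariance turn the coefficient defining \<open>R\<^sup>-(a\<^sup>2)\<close> into
  \<open>[z\<^sup>r] F(z) / (q (1 - b\<^sup>2 z))\<close>, and what remains is the identity
  \<open>(b - a / q) / (1 - b\<^sup>2 z) = 1 / (q (a + b q)) = \<omega> A\<^sub>C / (1 - \<omega>\<^sup>2 U\<^sub>C)\<close>.
\<close>

section \<open>Binomial series and the Catalan-type series in terms of q\<close>

lemma one_minus_pow_eq_compose:
  "one_minus_pow \<beta> = fps_binomial \<beta> oo (- fps_X)"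
  by (simp add: one_minus_pow_def fps_compose_uminus' mult.commute)

lemma one_minus_pow_add:
  "one_minus_pow (\<beta> + \<gamma>) = one_minus_pow \<beta> * one_minus_pow \<gamma>"
  by (simp add: one_minus_pow_eq_compose fps_binomial_add_mult fps_compose_mult_distrib)

lemma one_minus_pow_of_nat: "one_minus_pow (of_nat k) = (1 - fps_X) ^ k"
  by (simp add: one_minus_pow_eq_compose fps_binomial_of_nat fps_compose_add_distrib
      fps_compose_uminus flip: fps_compose_power)

lemma one_minus_pow_nth_0 [simp]: "fps_nth (one_minus_pow \<beta>) 0 = 1"
  by (simp add: one_minus_pow_def)

lemma one_minus_pow_half_square: "one_minus_pow (1/2) * one_minus_pow (1/2) = 1 - fps_X"
  using one_minus_pow_of_nat[of 1] by (simp flip: one_minus_pow_add)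

text \<open>With c for the rescaled Catalan series, the defining quotient gives c z = 2 (1 - q).
  Since z = (1 - q) (1 + q), cancelling 1 - q leaves the claim.\<close>

lemma catalan_quarter_eq:
  "fps_compose catalan_series (fps_const (1/4) * fps_X) * (1 + one_minus_pow (1/2)) = 2"
proof -
  define q where "q = one_minus_pow (1/2)"
  define s where "s = fps_compose q (fps_const 4 * fps_X)"
  define c where "c = fps_compose catalan_series (fps_const (1/4) * fps_X)"
  have q2: "q * q = 1 - fps_X"
    unfolding q_def by (rule one_minus_pow_half_square)
  \<comment> \<open>The divisor 2 z is not a unit, so the quotient defining
    \<open>catalan_series\<close> can be multiplied back only once divisibility is known. It holds
    because s has constant term 1.\<close>
  have "fps_const 2 * fps_X dvd 1 - s"
  proof -
    define t where "t = fps_shift 1 (1 - s)"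
    have "fps_nth (1 - s) n = fps_nth (fps_X * t) n" for n
      by (cases n) (simp_all add: t_def s_def q_def)
    hence t: "1 - s = fps_X * t"
      by (simp add: fps_eq_iff)
    have "1 - s = (fps_const 2 * fps_X) * (fps_const (1/2) * t)"
      by (simp add: t fps_eq_iff mult.assoc)
    thus ?thesis by simp
  qed
  hence "catalan_series * (fps_const 2 * fps_X) = 1 - s"
    unfolding catalan_series_def s_def q_def by simp
  hence "fps_compose (catalan_series * (fps_const 2 * fps_X)) (fps_const (1/4) * fps_X)
       = fps_compose (1 - s) (fps_const (1/4) * fps_X)"
    by simp
  moreover have "fps_compose s (fps_const (1/4) * fps_X) = q"
    by (simp add: s_def fps_compose_linear fps_eq_iff flip: power_mult_distrib)
  ultimately have "c * (fps_const 2 * (fps_const (1/4) * fps_X)) = 1 - q"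
    by (simp add: c_def fps_compose_mult_distrib fps_compose_sub_distrib)
  hence "fps_const 2 * (c * (fps_const 2 * (fps_const (1/4) * fps_X))) = fps_const 2 * (1 - q)"
    by simp
  moreover have "fps_const 2 * (c * (fps_const 2 * (fps_const (1/4) * fps_X))) = c * fps_X"
    by (simp add: fps_eq_iff mult_ac)
  ultimately have cX: "c * fps_X = 2 * (1 - q)"
    by (simp add: fps_numeral_fps_const)
  have "1 - q \<noteq> 0"
  proof
    assume "1 - q = 0"
    with q2 have "fps_X = (0 :: complex fps)" by simp
    thus False by simp
  qed
  moreover have "(1 - q) * (c * (1 + q)) = (1 - q) * 2"
    using cX q2 by algebra
  ultimately show ?thesis
    unfolding c_def q_def by (simp only: mult_cancel_left) simp
qed

lemma U_C_eq: "U_C * (1 + one_minus_pow (1/2)) = 1 - one_minus_pow (1/2)"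
  using catalan_quarter_eq by (simp add: U_C_def left_diff_distrib)

lemma U_C_nth_0: "fps_nth U_C 0 = 0"
  using arg_cong[OF U_C_eq, of "\<lambda>f. fps_nth f 0"] by simp

text \<open>By definition A_C q^2 = 2 - c, and c (1 + q) = 2 turns the right side into c q.
  Cancelling q gives A_C q = c, and multiplying by 1 + q gives 2.\<close>

lemma A_C_eq: "A_C * (one_minus_pow (1/2) * (1 + one_minus_pow (1/2))) = 2"
proof -
  define q where "q = one_minus_pow (1/2)"
  define c where "c = fps_compose catalan_series (fps_const (1/4) * fps_X)"
  have q2: "q * q = 1 - fps_X"
    unfolding q_def by (rule one_minus_pow_half_square)
  have c: "c * (1 + q) = 2"
    unfolding q_def c_def by (rule catalan_quarter_eq)
  have "A_C * (1 - fps_X) = (fps_const 2 - c) * (inverse (1 - fps_X) * (1 - fps_X))"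
    unfolding A_C_def c_def by (simp add: fps_divide_unit mult.assoc)
  hence "A_C * (q * q) = 2 - c"
    by (simp add: q2 inverse_mult_eq_1 fps_numeral_fps_const)
  hence "q * (A_C * (q * (1 + q))) = q * 2"
    using c by algebra
  moreover have "q \<noteq> 0"
    by (metis q_def one_minus_pow_nth_0 fps_zero_nth zero_neq_one)
  ultimately show ?thesis
    unfolding q_def by (simp only: mult_cancel_left) simp
qed

section \<open>Coefficient extraction under composition and Moebius covariance\<close>

lemma fps_nth_mult_compose:
  fixes G H P :: "'a :: idom fps"
  assumes "fps_nth P 0 = 0"
  shows "fps_nth (H * fps_compose G P) n = (\<Sum>k\<le>n. fps_nth G k * fps_nth (H * P ^ k) n)"
proof -
  \<comment> \<open>P^k has order at least k, so all coefficients of the composition up to index n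
    can be summed over the common range k \<le> n. This makes the exchange of sums possible.\<close>
  have vanish: "fps_nth (P ^ k) m = 0" if "m < k" for k m
    using startsby_zero_power_prefix[OF assms] that by blast
  have "fps_nth (fps_compose G P) m = (\<Sum>k\<le>n. fps_nth G k * fps_nth (P ^ k) m)" if "m \<le> n" for m
    unfolding fps_compose_nth using that
    by (intro sum.mono_neutral_left) (auto simp: vanish)
  hence "fps_nth (H * fps_compose G P) n
       = (\<Sum>i=0..n. fps_nth H i * (\<Sum>k\<le>n. fps_nth G k * fps_nth (P ^ k) (n - i)))"
    by (simp add: fps_mult_nth)
  also have "\<dots> = (\<Sum>k\<le>n. fps_nth G k * fps_nth (H * P ^ k) n)"
    by (simp add: fps_mult_nth sum_distrib_left mult_ac sum.swap[of _ "{0..n}"])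
  finally show ?thesis .
qed

text \<open>The formal residue \<open>Res G(w) dw / w\<^sup>r\<^sup>+\<^sup>1\<close> after the substitution \<open>w = z / (1 - z)\<close>.\<close>

lemma fps_nth_mobius_substitution:
  fixes G :: "complex fps"
  assumes "r \<ge> 1"
  shows "fps_nth ((1 - fps_X) ^ (r - 1) * fps_compose G (fps_X * inverse (1 - fps_X))) r
       = fps_nth G r"
proof -
  define v :: "complex fps" where "v = inverse (1 - fps_X)"
  have v: "(1 - fps_X) * v = 1"
    by (simp add: v_def inverse_mult_eq_1')
  \<comment> \<open>By linearity it suffices to treat G = w^k. The factor (1 - z)^(r-1) comes from
    dw / w^(r+1). For k < r the product z^k (1 - z)^(r-1-k) is a polynomial of degree r - 1; for k =
    r it is z^r / (1 - z).\<close>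
  have "fps_nth ((1 - fps_X) ^ (r - 1) * (fps_X * v) ^ k) r = (if k = r then 1 else 0)"
    if "k \<le> r" for k
  proof (cases "k = r")
    case True
    have "(1 - fps_X) ^ (r - 1) * (fps_X * v) ^ r = fps_X ^ r * ((1 - fps_X) ^ (r - 1) * v ^ r)"
      by (simp add: power_mult_distrib mult_ac)
    thus ?thesis
      using True by (simp only: fps_X_power_mult_nth) (simp add: fps_power_zeroth v_def)
  next
    case False
    with that have k: "k < r" by simp
    hence "(1 - fps_X) ^ (r - 1) = (1 - fps_X) ^ (r - 1 - k) * (1 - fps_X :: complex fps) ^ k"
      by (simp flip: power_add)
    hence "(1 - fps_X) ^ (r - 1) * (fps_X * v) ^ k
         = fps_X ^ k * ((1 - fps_X) ^ (r - 1 - k) * ((1 - fps_X) * v) ^ k)"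
      by (simp only: power_mult_distrib mult_ac)
    hence "(1 - fps_X) ^ (r - 1) * (fps_X * v) ^ k
         = fps_X ^ k * one_minus_pow (of_nat (r - 1 - k))"
      by (simp only: v one_minus_pow_of_nat power_one mult_1_right)
    moreover have "fps_nth (one_minus_pow (of_nat d)) (r - k) = 0" if "d < r - k" for d
      using that by (simp add: one_minus_pow_def flip: binomial_gbinomial)
    ultimately show ?thesis
      using k by (simp only: fps_X_power_mult_nth) simp
  qed
  hence "fps_nth ((1 - fps_X) ^ (r - 1) * fps_compose G (fps_X * v)) r
       = (\<Sum>k\<le>r. fps_nth G k * (if k = r then 1 else 0))"
    by (simp add: fps_nth_mult_compose)
  thus ?thesis
    by (simp add: v_def if_distrib cong: if_cong)
qed

text \<open>Under w = z / (1 - z) the denominator 1 - x w becomes (1 - (x + 1) z) / (1 - z), which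
  shifts x to x + 1. The powers of 1 - z have exponents r - 1 (substitution), 1 (denominator) and
  -(r + 1/2) (covariance); they add up to -1/2, that is 1 / q.\<close>

lemma R_minus_mobius:
  assumes r: "r \<ge> 1" and cov: "mobius_covariant (half_weight r) (F (half_weight r))"
  shows "R_minus F r x = 1 / half_weight r * fps_nth (F (half_weight r) *
           inverse (one_minus_pow (1/2)) * inverse (1 - fps_const (x + 1) * fps_X)) r"
proof -
  define f where "f = F (half_weight r)"
  define P :: "complex fps" where "P = fps_X * inverse (1 - fps_X)"
  define q where "q = one_minus_pow (1/2)"
  define G where "G = fps_compose f (- fps_X) * inverse (1 - fps_const x * fps_X)"
  define K :: "complex fps" where "K = 1 - fps_const (x + 1) * fps_X"
  have P0: "fps_nth P 0 = 0" by (simp add: P_def)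
  have P1: "P * (1 - fps_X) = fps_X"
    by (simp add: P_def mult.assoc inverse_mult_eq_1)
  have "G * (1 - fps_const x * fps_X) = fps_compose f (- fps_X)"
    by (simp add: G_def mult.assoc inverse_mult_eq_1)
  \<comment> \<open>The inner sign change followed by P is -z / (1 - z), exactly the map of the
    covariance hypothesis.\<close>
  hence "fps_compose (G * (1 - fps_const x * fps_X)) P = fps_compose (fps_compose f (- fps_X)) P"
    by simp
  also have "\<dots> = fps_compose f (- P)"
    using P0 by (simp add: fps_compose_assoc[symmetric] fps_compose_uminus)
  also have "\<dots> = one_minus_pow (- half_weight r) * f"
    using cov by (simp add: mobius_covariant_def f_def P_def fps_divide_unit)
  finally have "fps_compose G P * (1 - fps_const x * P) = one_minus_pow (- half_weight r) * f"
    using P0 by (simp add: fps_compose_mult_distrib fps_compose_sub_distrib)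
  hence GK: "fps_compose G P * K = one_minus_pow (- half_weight r) * f * (1 - fps_X)"
    using P1 unfolding K_def fps_const_add[symmetric] fps_const_1_eq_1 by algebra
  have pow: "(1 - fps_X) ^ (r - 1) * (1 - fps_X) = (1 - fps_X :: complex fps) ^ r"
    using r by (cases r) simp_all
  have "q * (one_minus_pow (- half_weight r) * (1 - fps_X) ^ r)
      = one_minus_pow (1/2 + (- half_weight r + of_nat r))"
    by (simp only: one_minus_pow_add one_minus_pow_of_nat q_def)
  also have "\<dots> = 1"
    using one_minus_pow_of_nat[of 0] by (simp add: half_weight_def)
  finally have "one_minus_pow (- half_weight r) * (1 - fps_X) ^ r = inverse q"
    using fps_inverse_unique by metis
  moreover have "(1 - fps_X) ^ (r - 1) * fps_compose G P * K
      = one_minus_pow (- half_weight r) * (1 - fps_X) ^ r * f"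
    unfolding pow[symmetric] mult.assoc GK by (simp only: mult_ac)
  ultimately have "(1 - fps_X) ^ (r - 1) * fps_compose G P * K = f * inverse q"
    by (simp only: mult_ac)
  moreover have "K * inverse K = 1"
    by (rule inverse_mult_eq_1') (simp add: K_def)
  ultimately have "(1 - fps_X) ^ (r - 1) * fps_compose G P = f * inverse q * inverse K"
    by (metis mult.assoc mult_1_right)
  with fps_nth_mobius_substitution[OF r, of G]
  have "fps_nth G r = fps_nth (f * inverse q * inverse K) r"
    by (simp add: P_def)
  thus ?thesis
    by (simp add: R_minus_def G_def f_def q_def K_def fps_divide_unit)
qed

section \<open>Geometric expansion and the one-step difference identity\<close>

lemma fps_truncated_geometric_nth:
  fixes U H :: "complex fps"
  assumes "fps_nth U 0 = 0"
  shows "(\<Sum>j\<le>r. c ^ j * fps_nth (H * U ^ j) r)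
       = fps_nth (H * inverse (1 - fps_const c * U)) r"
proof -
  define u where "u = fps_const c * U"
  have u0: "fps_nth u 0 = 0" using assms by (simp add: u_def)
  have inv: "(1 - u) * inverse (1 - u) = 1"
    using u0 by (simp add: inverse_mult_eq_1')
  have "(1 - u) * (\<Sum>j\<le>r. u ^ j) = 1 - u ^ Suc r"
    by (simp add: sum_gp_basic)
  hence "H * inverse (1 - u) * ((1 - u) * (\<Sum>j\<le>r. u ^ j))
       = H * inverse (1 - u) - H * inverse (1 - u) * u ^ Suc r"
    by (simp only: right_diff_distrib mult_1_right)
  moreover have "H * inverse (1 - u) * ((1 - u) * (\<Sum>j\<le>r. u ^ j)) = H * (\<Sum>j\<le>r. u ^ j)"
    using inv by (metis (no_types, lifting) mult.assoc mult.commute mult_1_left)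
  ultimately have "H * (\<Sum>j\<le>r. u ^ j) = H * inverse (1 - u) - H * inverse (1 - u) * u ^ Suc r"
    by simp
  \<comment> \<open>The remainder of the finite geometric sum has order greater than r, so it does
    not reach the coefficient at r.\<close>
  moreover have "fps_nth (H * inverse (1 - u) * u ^ Suc r) r = 0"
    using startsby_zero_power_prefix[OF u0, of "Suc r"]
    by (auto simp add: fps_mult_nth simp del: power_Suc intro!: sum.neutral)
  ultimately have "fps_nth (H * (\<Sum>j\<le>r. u ^ j)) r = fps_nth (H * inverse (1 - u)) r"
    by simp
  moreover have "fps_nth (H * u ^ j) r = c ^ j * fps_nth (H * U ^ j) r" for j
  proof -
    have "H * u ^ j = fps_const (c ^ j) * (H * U ^ j)"
      by (simp add: u_def power_mult_distrib mult_ac fps_const_power)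
    thus ?thesis by (simp only: fps_mult_left_const_nth)
  qed
  ultimately show ?thesis
    by (simp add: u_def[symmetric] sum_distrib_left fps_sum_nth)
qed

text \<open>Let \<omega> = b - a. The hypothesis yields both 1 - b^2 z = (b q - a) (b q + a) and
  \<omega> (a + b) = 1. The latter gives (1 + q) - \<omega>^2 (1 - q) = 2 \<omega> (a + b q), so
  both sides equal 1 / (q (a + b q)).\<close>

lemma fps_kernel_identity:
  fixes a b :: complex
  assumes ab: "b * b = a * a + 1"
  shows "fps_const b * inverse (1 - fps_const (b * b) * fps_X)
           - fps_const a * (inverse (one_minus_pow (1/2)) * inverse (1 - fps_const (b * b) * fps_X))
       = fps_const (b - a) * A_C * inverse (1 - fps_const ((b - a) * (b - a)) * U_C)"
proof -
  define q where "q = one_minus_pow (1/2)"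
  define A B where "A = fps_const a" and "B = fps_const b"
  define K :: "complex fps" where "K = 1 - fps_const (b * b) * fps_X"
  define W where "W = 1 - fps_const ((b - a) * (b - a)) * U_C"
  have AB: "B * B = A * A + 1"
    unfolding A_def B_def by (simp add: ab flip: fps_const_add)
  have K: "K = 1 - B * B * fps_X" and W: "W = 1 - (B - A) * (B - A) * U_C"
    by (simp_all add: K_def W_def A_def B_def)
  have q2: "q * q = 1 - fps_X"
    unfolding q_def by (rule one_minus_pow_half_square)
  have U: "U_C * (1 + q) = 1 - q" and AC: "A_C * (q * (1 + q)) = 2"
    unfolding q_def by (rule U_C_eq A_C_eq)+
  have q0: "fps_nth q 0 = 1" by (simp add: q_def)
  have invq: "q * inverse q = 1" and invK: "K * inverse K = 1" and invW: "W * inverse W = 1"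
    by (rule inverse_mult_eq_1', simp add: q0 K_def W_def U_C_nth_0)+
  have key: "(B * q - A) * (W * (1 + q)) = 2 * ((B - A) * K)"
    using U q2 AB unfolding K W by algebra
  \<comment> \<open>Multiplying by this common denominator makes the identity polynomial and
    accessible to \<open>algebra\<close>; its constant term is 2, so it can be cancelled
    afterwards.\<close>
  have nz: "q * (1 + q) * K * W \<noteq> 0"
  proof
    assume "q * (1 + q) * K * W = 0"
    from arg_cong[OF this, of "\<lambda>f. fps_nth f 0"] show False
      by (simp add: q0 K_def W_def U_C_nth_0)
  qed
  have "q * (1 + q) * K * W * (B * inverse K - A * (inverse q * inverse K))
      = (B * q - A) * (W * (1 + q))"
    using invq invK by algebra
  also have "\<dots> = q * (1 + q) * K * W * ((B - A) * A_C * inverse W)"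
    using key AC invW by algebra
  finally have "B * inverse K - A * (inverse q * inverse K) = (B - A) * A_C * inverse W"
    using nz by (simp only: mult_cancel_left) simp
  thus ?thesis
    by (simp add: A_def B_def q_def K_def W_def)
qed

text \<open>Covariance gives both terms the denominator 1 - b^2 z. Multiplying the kernel identity
  by F and expanding its right side in powers of (b - a)^2 \<open>U_C\<close> then produces the
  coefficients \<open>kappa\<close>.\<close>

lemma R_difference:
  assumes r: "r \<ge> 1" and cov: "mobius_covariant (half_weight r) (F (half_weight r))"
    and ab: "b * b = a * a + 1"
  shows "b * R_plus F r (b * b) - a * R_minus F r (a * a)
       = (\<Sum>j\<le>r. kappa F r j * (b - a) ^ (2 * j + 1))"
proof -
  define f where "f = F (half_weight r)"
  define q where "q = one_minus_pow (1/2)"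
  define K :: "complex fps" where "K = 1 - fps_const (b * b) * fps_X"
  define h where "h = 1 / half_weight r"
  define c where "c = (b - a) * (b - a)"
  have plus: "R_plus F r (b * b) = h * fps_nth (f * inverse K) r"
    by (simp add: R_plus_def f_def h_def K_def fps_divide_unit)
  have minus: "R_minus F r (a * a) = h * fps_nth (f * inverse q * inverse K) r"
    by (simp add: R_minus_mobius[where F = F, OF r cov] f_def h_def K_def q_def ab)
  have "b * R_plus F r (b * b) - a * R_minus F r (a * a)
      = h * fps_nth (f * (fps_const b * inverse K - fps_const a * (inverse q * inverse K))) r"
  proof -
    have "f * (fps_const b * inverse K - fps_const a * (inverse q * inverse K))
        = fps_const b * (f * inverse K) - fps_const a * (f * inverse q * inverse K)"
      by (simp add: right_diff_distrib mult_ac)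
    thus ?thesis
      unfolding plus minus
      by (simp only: fps_sub_nth fps_mult_left_const_nth) (simp add: right_diff_distrib)
  qed
  also have "fps_const b * inverse K - fps_const a * (inverse q * inverse K)
           = fps_const (b - a) * A_C * inverse (1 - fps_const c * U_C)"
    unfolding K_def q_def c_def by (rule fps_kernel_identity[OF ab])
  also have "h * fps_nth (f * (fps_const (b - a) * A_C * inverse (1 - fps_const c * U_C))) r
           = h * (b - a) * fps_nth (f * A_C * inverse (1 - fps_const c * U_C)) r"
  proof -
    have "f * (fps_const (b - a) * A_C * inverse (1 - fps_const c * U_C))
        = fps_const (b - a) * (f * A_C * inverse (1 - fps_const c * U_C))"
      by (simp only: mult_ac)
    thus ?thesis by (simp only: fps_mult_left_const_nth mult.assoc)
  qed
  also have "\<dots> = h * (b - a) * (\<Sum>j\<le>r. c ^ j * fps_nth (f * A_C * U_C ^ j) r)"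
    by (simp only: fps_truncated_geometric_nth[OF U_C_nth_0])
  also have "\<dots> = (\<Sum>j\<le>r. kappa F r j * (b - a) ^ (2 * j + 1))"
    unfolding sum_distrib_left
    by (rule sum.cong) (simp_all add: kappa_def f_def h_def c_def power_mult power2_eq_square)
  finally show ?thesis .
qed

section \<open>Telescoping Ramanujan tails and the summation formula\<close>

lemma ramanujan_tail_diff:
  assumes "m \<ge> 3"
  shows "ramanujan_tail n m - ramanujan_tail (Suc n) m = (sqrt (real (Suc n)) - sqrt (real n)) ^ m"
proof -
  define g where "g \<nu> = 1 / (sqrt (real n + real \<nu>) + sqrt (real n + real \<nu> + 1)) ^ m" for \<nu> :: nat
  \<comment> \<open>Splitting off the head uses convergence, hence m \<ge> 3; the shifted series is
    the tail started at n + 1.\<close>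
  have "suminf g = (\<Sum>\<nu>. g (Suc \<nu>)) + g 0"
    using suminf_split_head[of g] summable_ramanujan_tail[OF assms, of n]
    by (simp add: g_def[abs_def])
  moreover have "(\<lambda>\<nu>. g (Suc \<nu>))
      = (\<lambda>\<nu>. 1 / (sqrt (real (Suc n) + real \<nu>) + sqrt (real (Suc n) + real \<nu> + 1)) ^ m)"
    by (simp add: g_def add_ac)
  ultimately have "ramanujan_tail n m - ramanujan_tail (Suc n) m = g 0"
    by (simp add: ramanujan_tail_def g_def[abs_def])
  also have "\<dots> = (1 / (sqrt (real n) + sqrt (real (Suc n)))) ^ m"
    by (simp add: g_def power_one_over add_ac)
  also have "1 / (sqrt (real n) + sqrt (real (Suc n))) = sqrt (real (Suc n)) - sqrt (real n)"
  proof -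
    have "sqrt (real n) + sqrt (real (Suc n)) > 0"
      by (simp add: add_nonneg_pos)
    moreover have "(sqrt (real (Suc n)) - sqrt (real n)) * (sqrt (real n) + sqrt (real (Suc n))) = 1"
      by (simp add: algebra_simps)
    ultimately show ?thesis by (simp add: divide_eq_eq)
  qed
  finally show ?thesis .
qed

text \<open>Induction on n: \<open>C_const\<close> is chosen so that the case n = 1 is an identity,
  and the increments of the two sides from n to n + 1 agree by \<open>R_difference\<close>.\<close>

lemma s_term_sum:
  assumes r: "r \<ge> 1" and cov: "mobius_covariant (half_weight r) (F (half_weight r))"
    and n: "n \<ge> 1"
  shows "(\<Sum>l=1..n. s_term F r l) =
           C_const F r + of_real (sqrt (real n)) * (R_minus F r (of_nat n) - kappa F r 0)
           + (\<Sum>j=1..r. kappa F r j * of_real (ramanujan_tail n (2 * j + 1)))"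
  using n
proof (induction n rule: dec_induct)
  case base
  show ?case by (simp add: C_const_def)
next
  case (step n)
  define a b :: complex
    where "a = of_real (sqrt (real n))" and "b = of_real (sqrt (real (Suc n)))"
  have aa: "a * a = of_nat n" and bb: "b * b = of_nat (Suc n)"
    by (simp_all add: a_def b_def del: of_nat_Suc flip: of_real_mult)
  have tail: "of_real (ramanujan_tail n (2 * j + 1))
      = of_real (ramanujan_tail (Suc n) (2 * j + 1)) + (b - a) ^ (2 * j + 1)" if "j \<ge> 1" for j
  proof -
    have "ramanujan_tail n (2 * j + 1)
        = ramanujan_tail (Suc n) (2 * j + 1) + (sqrt (real (Suc n)) - sqrt (real n)) ^ (2 * j + 1)"
      using ramanujan_tail_diff[of "2 * j + 1" n] that by linarith
    thus ?thesis
      by (simp only: a_def b_def of_real_add of_real_diff of_real_power)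
  qed
  have "b * R_plus F r (of_nat (Suc n)) - a * R_minus F r (of_nat n)
      = (\<Sum>j\<le>r. kappa F r j * (b - a) ^ (2 * j + 1))"
    using R_difference[where F = F, OF r cov, of b a] aa bb by simp
  \<comment> \<open>The index 0 is treated apart because a tail of exponent 1 would diverge. Its
    contribution \<open>kappa F r 0 * (b - a)\<close> is instead the increment of
    \<open>kappa F r 0\<close> times the square root of n.\<close>
  also have "{..r} = insert 0 {1..r}" by auto
  finally have diff: "b * R_plus F r (of_nat (Suc n)) - a * R_minus F r (of_nat n)
      = kappa F r 0 * (b - a) + (\<Sum>j=1..r. kappa F r j * (b - a) ^ (2 * j + 1))"
    by simp
  have tails: "(\<Sum>j=1..r. kappa F r j * of_real (ramanujan_tail n (2 * j + 1)))
      = (\<Sum>j=1..r. kappa F r j * of_real (ramanujan_tail (Suc n) (2 * j + 1)))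
        + (\<Sum>j=1..r. kappa F r j * (b - a) ^ (2 * j + 1))"
    by (simp only: sum.distrib[symmetric] distrib_left[symmetric])
       (rule sum.cong, simp_all only: tail atLeastAtMost_iff)
  have s: "s_term F r (Suc n) = b * R_minus F r (of_nat (Suc n)) - b * R_plus F r (of_nat (Suc n))"
    by (simp only: s_term_def D_diff_def b_def right_diff_distrib)
  have "(\<Sum>l=1..Suc n. s_term F r l) = (\<Sum>l=1..n. s_term F r l) + s_term F r (Suc n)"
    by simp
  also have "\<dots> = C_const F r + b * (R_minus F r (of_nat (Suc n)) - kappa F r 0)
           + (\<Sum>j=1..r. kappa F r j * of_real (ramanujan_tail (Suc n) (2 * j + 1)))"
    unfolding step.IH tails s a_def[symmetric] using diff by algebra
  finally show ?case
    by (simp only: b_def)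
qed

section \<open>Explicit formulas through the odd coefficients\<close>

lemma fps_nth_divide_one_minus_const_X:
  fixes f :: "'a :: field fps"
  shows "fps_nth (f / (1 - fps_const x * fps_X)) r = (\<Sum>m\<le>r. fps_nth f m * x ^ (r - m))"
proof -
  have "(1 - fps_const x * fps_X) * Abs_fps (\<lambda>n. x ^ n) = 1"
  proof (rule fps_ext)
    fix n
    show "fps_nth ((1 - fps_const x * fps_X) * Abs_fps (\<lambda>n. x ^ n)) n = fps_nth 1 n"
      by (cases n) (simp_all add: left_diff_distrib mult.assoc)
  qed
  hence "inverse (1 - fps_const x * fps_X) = Abs_fps (\<lambda>n. x ^ n)"
    by (rule fps_inverse_unique)
  thus ?thesis
    by (simp add: fps_divide_unit fps_mult_nth atLeast0AtMost)
qed

lemma D_diff_eq: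
  "D_diff F r x = - (2 / half_weight r) *
     (\<Sum>m | 1 \<le> m \<and> m \<le> r \<and> odd m. fps_nth (F (half_weight r)) m * x ^ (r - m))"
proof -
  define t where "t m = fps_nth (F (half_weight r)) m * x ^ (r - m)" for m
  have "R_minus F r x = 1 / half_weight r * (\<Sum>m\<le>r. (-1) ^ m * t m)"
    and "R_plus F r x = 1 / half_weight r * (\<Sum>m\<le>r. t m)"
    by (simp_all add: R_minus_def R_plus_def fps_nth_divide_one_minus_const_X
        fps_compose_uminus' t_def mult.assoc)
  hence "D_diff F r x = 1 / half_weight r * (\<Sum>m\<le>r. ((-1) ^ m - 1) * t m)"
    by (simp add: D_diff_def sum_subtractf left_diff_distrib diff_divide_distrib)
  \<comment> \<open>The factor vanishes for even m, in particular for m = 0, and equals -2 for odd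
    m.\<close>
  also have "(\<Sum>m\<le>r. ((-1) ^ m - 1) * t m)
           = (\<Sum>m | 1 \<le> m \<and> m \<le> r \<and> odd m. ((-1) ^ m - 1) * t m)"
    by (rule sum.mono_neutral_right) (auto intro: odd_pos simp: Suc_le_eq)
  also have "\<dots> = (\<Sum>m | 1 \<le> m \<and> m \<le> r \<and> odd m. - 2 * t m)"
    by (rule sum.cong) simp_all
  finally show ?thesis
    by (simp add: t_def sum_negf flip: sum_distrib_left)
qed

text \<open>Here \<open>r - m\<close> on the left is truncated subtraction; m \<le> r makes it agree
  with the real exponent on the right.\<close>

lemma sqrt_mult_power_eq_powr:
  assumes "n \<ge> 1" and "m \<le> r"
  shows "sqrt (real n) * real n ^ (r - m) = real n powr (real r - real m + 1/2)"
  using assms by (simp add: powr_add powr_half_sqrt mult.commute flip: powr_realpow of_nat_diff)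

theorem theorem3p3:
  fixes F :: "complex \<Rightarrow> complex fps" and I :: "complex set" and r :: nat
  assumes weights: "\<And>k :: nat. half_weight k \<in> I"
    and covariant: "\<And>\<alpha>. \<alpha> \<in> I \<Longrightarrow> mobius_covariant \<alpha> (F \<alpha>)"
    and r: "r \<ge> 1"
  shows "(\<forall>n :: nat. n \<ge> 1 \<longrightarrow>
            (\<Sum>l=1..n. s_term F r l) =
              C_const F r
              + of_real (sqrt (real n)) * (R_minus F r (of_nat n) - kappa F r 0)
              + (\<Sum>j=1..r. kappa F r j * of_real (ramanujan_tail n (2 * j + 1))))
       \<and> (\<forall>x :: complex.
            D_diff F r x =
              - (2 / half_weight r) *
                (\<Sum>m | 1 \<le> m \<and> m \<le> r \<and> odd m.
                   fps_nth (F (half_weight r)) m * x ^ (r - m)))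
       \<and> (\<forall>n :: nat. n \<ge> 1 \<longrightarrow>
            s_term F r n =
              - (2 / half_weight r) *
                (\<Sum>m | 1 \<le> m \<and> m \<le> r \<and> odd m.
                   fps_nth (F (half_weight r)) m
                   * of_real (real n powr (real r - real m + 1/2))))"
proof (intro conjI allI impI)
  fix n :: nat
  assume "n \<ge> 1"
  thus "(\<Sum>l=1..n. s_term F r l) =
          C_const F r
          + of_real (sqrt (real n)) * (R_minus F r (of_nat n) - kappa F r 0)
          + (\<Sum>j=1..r. kappa F r j * of_real (ramanujan_tail n (2 * j + 1)))"
    by (rule s_term_sum[where F = F, OF r covariant[OF weights]])
next
  show "D_diff F r x = - (2 / half_weight r) *
          (\<Sum>m | 1 \<le> m \<and> m \<le> r \<and> odd m. fps_nth (F (half_weight r)) m * x ^ (r - m))" for x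
    by (rule D_diff_eq)
next
  fix n :: nat
  assume n: "n \<ge> 1"
  have "of_real (real n powr (real r - real m + 1/2))
      = (of_real (sqrt (real n)) * of_nat n ^ (r - m) :: complex)" if "m \<le> r" for m
    using sqrt_mult_power_eq_powr[OF n that] by (metis of_real_mult of_real_of_nat_eq of_real_power)
  hence "(\<Sum>m | 1 \<le> m \<and> m \<le> r \<and> odd m. fps_nth (F (half_weight r)) m
             * of_real (real n powr (real r - real m + 1/2)))
      = of_real (sqrt (real n)) *
        (\<Sum>m | 1 \<le> m \<and> m \<le> r \<and> odd m. fps_nth (F (half_weight r)) m * of_nat n ^ (r - m))"
    unfolding sum_distrib_left by (intro sum.cong) (simp_all add: mult_ac)
  thus "s_term F r n = - (2 / half_weight r) *
          (\<Sum>m | 1 \<le> m \<and> m \<le> r \<and> odd m. fps_nth (F (half_weight r)) m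
             * of_real (real n powr (real r - real m + 1/2)))"
    by (simp add: s_term_def D_diff_eq mult_ac)
qed

end
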